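(* Fix a finite $t>0$ and suppose that the included angle function $z=(x,y)\mapsto\theta(z,t)$ between the finite-time stable and unstable foliations is $C^1$ on an open set $\Omega\subset\mathbb{R}^2$. Let $z_0=(x_0,y_0)\in\Omega$ satisfy $\theta(z_0,t)=0$. (i) If $\theta_y(z_0,t)\neq 0$, then in a neighborhood of $z_0$ the set $\{z:\theta(z,t)=0\}$ is a $C^1$ curve that can be written as the graph $y=g_1(x)$ of a $C^1$ function $g_1$, and $g_1$ solves the initial value problem $\dfrac{dy}{dx}=-\dfrac{\theta_x}{\theta_y}$, $y(x_0)=y_0$. (ii) If $\theta_x(z_0,t)\neq 0$, then in a neighborhood of $z_0$ the set $\{z:\theta(z,t)=0\}$ is a $C^1$ curve that can be written as the graph $x=g_2(y)$ of a $C^1$ function $g_2$, and $g_2$ solves the initial value problem $\dfrac{dx}{dy}=-\dfrac{\theta_y}{\theta_x}$, $x(y_0)=x_0$.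
   Context: Let $\dot z=G(z,t)$ be a nonautonomous planar system whose vector field is regular enough to generate a flow; $\Phi_t(z)$ denotes the time-$t$ image of the point $z$ started at time $0$ (also for negative $t$), and $D\Phi_t$ its Jacobian matrix. Write a singular value decomposition $D\Phi_t(z)=U\Sigma V^*$ with $\Sigma=\mathrm{diag}(\sigma_1,\sigma_2)$, $\sigma_1\ge\sigma_2\ge 0$, and $V=[v_1|v_2]$; the finite-time stable foliation at $z$ is $f_s^t(z)=v_2$, the second right singular vector. Write likewise $D\Phi_t(\Phi_{-t}(z))=\overline U\,\overline\Sigma\,\overline V^*$, where $D\Phi_t(\Phi_{-t}(z))$ is the Jacobian matrix of the flow map carrying $\Phi_{-t}(z)$ to $z$; the finite-time unstable foliation at $z$ is $f_u^t(z)=\overline u_1$, the first left singular vector. The included angle $\theta(z,t)\in[-\pi/2,\pi/2]$ of the finite-time stable and unstable foliations at $z$ is the (signed) angle between the directions $f_s^t(z)$ and $f_u^t(z)$ (vectors determined up to sign), with $$\cos\theta(z,t)=\frac{\langle f_s^t(z),f_u^t(z)\rangle}{\|f_s^t(z)\|_2\,\|f_u^t(z)\|_2}$$ for representatives having nonnegative inner product. Subscripts $x,y$ on $\theta$ denote partial derivatives with respect to $z=(x,y)$. *)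

theory Defs
  imports "HOL-Analysis.Analysis"
begin

definition solves_ode :: "(real^2 \<Rightarrow> real \<Rightarrow> real^2) \<Rightarrow> (real \<Rightarrow> real^2) \<Rightarrow> bool" where
  "solves_ode G u \<longleftrightarrow> (\<forall>\<tau>. (u has_vector_derivative G (u \<tau>) \<tau>) (at \<tau>))"

text \<open>
  The two-parameter flow: \<^term>\<open>\<phi> s \<tau> z\<close> is the position at time \<^term>\<open>\<tau>\<close> of the solution that
  is at \<^term>\<open>z\<close> at time \<^term>\<open>s\<close>. The time-\<open>t\<close> map \<open>\<Phi>\<^sub>t\<close> started at time 0 is \<^term>\<open>\<phi> 0 t\<close>.
  The only smoothness demanded of the flow maps is that their Jacobians exist.
\<close>

definition generates_flow ::
  "(real^2 \<Rightarrow> real \<Rightarrow> real^2) \<Rightarrow> (real \<Rightarrow> real \<Rightarrow> real^2 \<Rightarrow> real^2) \<Rightarrow> bool" where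
  "generates_flow G \<phi> \<longleftrightarrow>
     (\<forall>s z. \<phi> s s z = z \<and> solves_ode G (\<lambda>\<tau>. \<phi> s \<tau> z) \<and>
            (\<forall>u. u s = z \<and> solves_ode G u \<longrightarrow> u = (\<lambda>\<tau>. \<phi> s \<tau> z))) \<and>
     (\<forall>s \<tau> z. \<phi> s \<tau> differentiable (at z))"

definition is_svd :: "real^2^2 \<Rightarrow> real^2^2 \<Rightarrow> real \<Rightarrow> real \<Rightarrow> real^2^2 \<Rightarrow> bool" where
  "is_svd A U \<sigma>1 \<sigma>2 V \<longleftrightarrow>
     orthogonal_matrix U \<and> orthogonal_matrix V \<and> \<sigma>1 \<ge> \<sigma>2 \<and> \<sigma>2 \<ge> 0 \<and>
     A = U ** vector [vector [\<sigma>1, 0], vector [0, \<sigma>2]] ** transpose V"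

text \<open>
  A singular value decomposition is not unique (singular vectors are determined only up to sign,
  and not even that if the singular values coincide), so the foliation directions are relations.
\<close>

definition stable_foliation ::
  "(real \<Rightarrow> real \<Rightarrow> real^2 \<Rightarrow> real^2) \<Rightarrow> real \<Rightarrow> real^2 \<Rightarrow> real^2 \<Rightarrow> bool" where
  "stable_foliation \<phi> t z v \<longleftrightarrow>
     (\<exists>U \<sigma>1 \<sigma>2 V. is_svd (jacobian (\<phi> 0 t) (at z)) U \<sigma>1 \<sigma>2 V \<and> v = column 2 V)"

text \<open>
  For a nonautonomous field, the flow map carrying \<open>\<Phi>\<^sub>-\<^sub>t(z)\<close> to \<open>z\<close> runs from time \<open>-t\<close> to time 0;
  it is \<^term>\<open>\<phi> (-t) 0\<close>, which in general differs from \<^term>\<open>\<phi> 0 t\<close>.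
\<close>

definition unstable_foliation ::
  "(real \<Rightarrow> real \<Rightarrow> real^2 \<Rightarrow> real^2) \<Rightarrow> real \<Rightarrow> real^2 \<Rightarrow> real^2 \<Rightarrow> bool" where
  "unstable_foliation \<phi> t z u \<longleftrightarrow>
     (\<exists>U \<sigma>1 \<sigma>2 V. is_svd (jacobian (\<phi> (-t) 0) (at (\<phi> 0 (-t) z))) U \<sigma>1 \<sigma>2 V \<and> u = column 1 U)"

text \<open>
  The sign convention is the usual orientation of the plane: the angle is counted counterclockwise
  from the stable to the unstable direction, which is what the sine condition says. For
  orthogonal directions both \<open>\<pi>/2\<close> and \<open>-\<pi>/2\<close> are included angles.
\<close>

definition included_angle ::
  "(real \<Rightarrow> real \<Rightarrow> real^2 \<Rightarrow> real^2) \<Rightarrow> real \<Rightarrow> real^2 \<Rightarrow> real \<Rightarrow> bool" where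
  "included_angle \<phi> t z \<alpha> \<longleftrightarrow>
     \<alpha> \<in> {-pi/2..pi/2} \<and>
     (\<exists>s u. stable_foliation \<phi> t z s \<and> unstable_foliation \<phi> t z u \<and> s \<bullet> u \<ge> 0 \<and>
        cos \<alpha> = (s \<bullet> u) / (norm s * norm u) \<and>
        sin \<alpha> = (s$1 * u$2 - s$2 * u$1) / (norm s * norm u))"

definition C1_on :: "(real^2 \<Rightarrow> real) \<Rightarrow> (real^2) set \<Rightarrow> bool" where
  "C1_on f S \<longleftrightarrow>
     (\<exists>f' :: real^2 \<Rightarrow> ((real^2) \<Rightarrow>\<^sub>L real).
        (\<forall>z\<in>S. (f has_derivative blinfun_apply (f' z)) (at z)) \<and> continuous_on S f')"

definition partial_deriv :: "2 \<Rightarrow> (real^2 \<Rightarrow> real) \<Rightarrow> real^2 \<Rightarrow> real" where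
  "partial_deriv i f z = deriv (\<lambda>h. f (z + h *\<^sub>R axis i 1)) 0"

definition solves_ivp_on ::
  "real set \<Rightarrow> (real \<Rightarrow> real \<Rightarrow> real) \<Rightarrow> real \<Rightarrow> real \<Rightarrow> (real \<Rightarrow> real) \<Rightarrow> bool" where
  "solves_ivp_on I F a b g \<longleftrightarrow>
     a \<in> I \<and> g a = b \<and> (\<forall>r\<in>I. (g has_real_derivative F r (g r)) (at r))"

end

theory Submission
  imports Defs
begin

text \<open>
  The claim is the implicit function theorem in the plane for the included angle, together with the
  formula for the slope of a level curve. Given a \<open>C\<^sup>1\<close> function \<open>f\<close> with
  \<open>\<partial>f/\<partial>z\<^sub>j \<noteq> 0\<close> at a zero \<open>z0\<close>, the map \<open>H\<close> that keeps the other coordinate \<open>z\<^sub>i\<close> and replaces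
  \<open>z\<^sub>j\<close> by \<open>f z\<close> has an invertible derivative at \<open>z0\<close>, so it is a local diffeomorphism by the
  inverse function theorem. It straightens the zero set of \<open>f\<close> into the \<open>i\<close>-axis, and because it
  preserves \<open>z\<^sub>i\<close>, the local inverse carries the axis back to a graph over \<open>z\<^sub>i\<close>. Differentiating
  \<open>f = 0\<close> along this graph gives the differential equation.

  The two parts of the theorem differ only in which coordinate is solved for. The lemma
  \<open>zero_set_locally_graph\<close> is therefore stated for two distinct indices \<open>i\<close> and \<open>j\<close> and is used
  once for each order of the coordinates.
\<close>

lemma plane_coordinates:
  fixes z :: "real^2" and i j :: 2
  assumes "i \<noteq> j"
  shows "z = z $ i *\<^sub>R axis i 1 + z $ j *\<^sub>R axis j 1"
proof -
  have "k = i \<or> k = j" for k :: 2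
    using assms exhaust_2[of k] exhaust_2[of i] exhaust_2[of j] by auto
  then show ?thesis
    using assms by (auto simp: vec_eq_iff axis_def)
qed

text \<open>
  Besides the graph itself, the conclusion records that \<open>\<partial>f/\<partial>z\<^sub>j\<close> does not vanish anywhere along the
  curve: this makes the right-hand side of the differential equation meaningful and continuous, so
  that \<open>g\<close> is \<open>C\<^sup>1\<close> and not just differentiable.
\<close>

lemma zero_set_locally_graph:
  fixes f :: "real^2 \<Rightarrow> real" and f' :: "real^2 \<Rightarrow> (real^2) \<Rightarrow>\<^sub>L real" and i j :: 2
  assumes ij: "i \<noteq> j"
    and "open S"
    and der: "\<forall>z\<in>S. (f has_derivative blinfun_apply (f' z)) (at z)"
    and cont: "continuous_on S f'"
    and "z0 \<in> S" and "f z0 = 0"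
    and nz: "f' z0 (axis j 1) \<noteq> 0"
  obtains N a b g where "open N" "z0 \<in> N" "N \<subseteq> S" "z0 $ i \<in> {a<..<b}" "g (z0 $ i) = z0 $ j"
    "{z\<in>N. f z = 0} = (\<lambda>x. x *\<^sub>R axis i 1 + g x *\<^sub>R axis j 1) ` {a<..<b}"
    "\<And>x. x \<in> {a<..<b} \<Longrightarrow> f' (x *\<^sub>R axis i 1 + g x *\<^sub>R axis j 1) (axis j 1) \<noteq> 0"
    "\<And>x. x \<in> {a<..<b} \<Longrightarrow> (g has_real_derivative
        - (f' (x *\<^sub>R axis i 1 + g x *\<^sub>R axis j 1) (axis i 1) /
           f' (x *\<^sub>R axis i 1 + g x *\<^sub>R axis j 1) (axis j 1))) (at x)"
    "g C1_differentiable_on {a<..<b}"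
proof -
  define ei ej :: "real^2" where "ei = axis i 1" and "ej = axis j 1"
  have comp [simp]: "ei $ i = 1" "ei $ j = 0" "ej $ i = 0" "ej $ j = 1"
    using ij by (auto simp: ei_def ej_def axis_def)
  have split: "z = z $ i *\<^sub>R ei + z $ j *\<^sub>R ej" for z :: "real^2"
    unfolding ei_def ej_def by (rule plane_coordinates[OF ij])
  have eqI: "z = w" if "z $ i = w $ i" "z $ j = w $ j" for z w :: "real^2"
    using split[of z] split[of w] that by simp
  have f'_split: "f' z h = h $ i * f' z ei + h $ j * f' z ej" for z h
    by (subst split[of h]) (simp add: blinfun.add_right blinfun.scaleR_right)

  define H where "H z = z $ i *\<^sub>R ei + f z *\<^sub>R ej" for z
  define H' where "H' z = Blinfun (\<lambda>h. h $ i *\<^sub>R ei) + (Blinfun (\<lambda>r. r *\<^sub>R ej) o\<^sub>L f' z)" for z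
  have bl1: "bounded_linear (\<lambda>h::real^2. h $ i *\<^sub>R ei)" and bl2: "bounded_linear (\<lambda>r. r *\<^sub>R ej)"
    by (intro bounded_linear_scaleR_left bounded_linear_compose[OF bounded_linear_scaleR_left]
          bounded_linear_vec_nth)+
  have H'_apply: "H' z h = h $ i *\<^sub>R ei + f' z h *\<^sub>R ej" for z h
    by (simp add: H'_def blinfun.add_left bounded_linear_Blinfun_apply bl1 bl2)
  have H_comp [simp]: "H z $ i = z $ i" "H z $ j = f z" for z
    by (simp_all add: H_def)
  have derH: "(H has_derivative H' z) (at z)" if "z \<in> S" for z
    unfolding H_def H'_apply
    by (rule derivative_eq_intros der[rule_format, OF that] bounded_linear.has_derivative[OF bounded_linear_vec_nth] refl)+
      simp
  have contH: "continuous_on S H'"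
    unfolding H'_def by (intro continuous_intros cont)

  \<comment> \<open>In the basis \<open>ei\<close>, \<open>ej\<close> the derivative of \<open>H\<close> is triangular with diagonal \<open>1\<close>, \<open>f' z0 ej\<close>,
    which gives its inverse explicitly.\<close>
  define invH where
    "invH = Blinfun (\<lambda>w::real^2. w $ i *\<^sub>R ei + ((w $ j - w $ i * f' z0 ei) / f' z0 ej) *\<^sub>R ej)"
  have "bounded_linear (\<lambda>w::real^2. w $ i *\<^sub>R ei + ((w $ j - w $ i * f' z0 ei) / f' z0 ej) *\<^sub>R ej)"
    unfolding divide_inverse
    by (intro bounded_linear_add bounded_linear_sub bounded_linear_vec_nth
          bounded_linear_compose[OF bounded_linear_scaleR_left]
          bounded_linear_compose[OF bounded_linear_mult_left])
  then have "invH w = w $ i *\<^sub>R ei + ((w $ j - w $ i * f' z0 ei) / f' z0 ej) *\<^sub>R ej" for w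
    by (simp add: invH_def bounded_linear_Blinfun_apply)
  then have "invH (H' z0 h) = h" for h
    using nz by (intro eqI) (simp_all add: H'_apply f'_split[of z0 h] flip: ej_def)
  then have "invH o\<^sub>L H' z0 = id_blinfun"
    by (intro blinfun_eqI) simp
  from inverse_function_theorem[OF \<open>open S\<close> derH contH \<open>z0 \<in> S\<close> this]
  obtain U V k k' where U: "open U" "U \<subseteq> S" "z0 \<in> U" and V: "open V" "H z0 \<in> V"
    and hom: "homeomorphism U V H k"
    and derk: "\<And>y. y \<in> V \<Longrightarrow> (k has_derivative k' y) (at y)"
    and bij: "\<And>y. y \<in> V \<Longrightarrow> bij (H' (k y))"
    by metis
  have kH: "k (H z) = z" "H z \<in> V" if "z \<in> U" for z
    using hom that by (auto simp: homeomorphism_def)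
  have Hk: "H (k y) = y" "k y \<in> U" if "y \<in> V" for y
    using hom that by (auto simp: homeomorphism_def)

  \<comment> \<open>The image of the zero set lies on the \<open>i\<close>-axis, which meets \<open>V\<close> in an open set of parameters.\<close>
  have Hzero: "H z = z $ i *\<^sub>R ei" if "f z = 0" for z
    using that by (simp add: H_def)
  have "open ((\<lambda>x. x *\<^sub>R ei) -` V)"
    by (intro open_vimage V(1) continuous_intros)
  moreover have "z0 $ i \<in> (\<lambda>x. x *\<^sub>R ei) -` V"
    using V(2) Hzero[OF \<open>f z0 = 0\<close>] by simp
  ultimately obtain d where "d > 0" and d: "ball (z0 $ i) d \<subseteq> (\<lambda>x. x *\<^sub>R ei) -` V"
    by (meson open_contains_ball)
  define a b where "a = z0 $ i - d" and "b = z0 $ i + d"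
  have ab: "z0 $ i \<in> {a<..<b}"
    using \<open>d > 0\<close> by (simp add: a_def b_def)
  have axisV: "x *\<^sub>R ei \<in> V" if "x \<in> {a<..<b}" for x
    using d that by (auto simp: a_def b_def ball_eq_greaterThanLessThan)

  define g where "g x = k (x *\<^sub>R ei) $ j" for x
  define p where "p x = x *\<^sub>R ei + g x *\<^sub>R ej" for x
  have k_eq_p: "k (x *\<^sub>R ei) = p x" and fp: "f (p x) = 0" if "x \<in> {a<..<b}" for x
  proof -
    have H_eq: "H (k (x *\<^sub>R ei)) = x *\<^sub>R ei"
      using Hk axisV[OF that] by simp
    have "k (x *\<^sub>R ei) $ i = x"
      using H_comp(1)[of "k (x *\<^sub>R ei)"] H_eq by simp
    moreover have "f (k (x *\<^sub>R ei)) = 0"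
      using H_comp(2)[of "k (x *\<^sub>R ei)"] H_eq by simp
    ultimately show "k (x *\<^sub>R ei) = p x"
      by (intro eqI) (simp_all add: p_def g_def)
    with \<open>f (k (x *\<^sub>R ei)) = 0\<close> show "f (p x) = 0"
      by simp
  qed
  have pU: "p x \<in> U" if "x \<in> {a<..<b}" for x
    using Hk(2)[OF axisV[OF that]] k_eq_p[OF that] by simp

  \<comment> \<open>As \<open>H\<close> preserves the \<open>i\<close>-th coordinate, cutting \<open>U\<close> down to a strip makes the zero set lie
    over exactly the interval of parameters.\<close>
  define N where "N = U \<inter> (\<lambda>z. z $ i) -` {a<..<b}"
  have "open N"
    unfolding N_def by (intro open_Int U(1) open_vimage open_greaterThanLessThan continuous_intros)
  have zero_set: "{z\<in>N. f z = 0} = p ` {a<..<b}"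
  proof (intro equalityI subsetI)
    fix z assume z: "z \<in> {z\<in>N. f z = 0}"
    then have "z = k (z $ i *\<^sub>R ei)"
      using kH(1)[of z] Hzero[of z] by (simp add: N_def)
    with z k_eq_p[of "z $ i"] show "z \<in> p ` {a<..<b}"
      by (auto simp: N_def)
  next
    fix z assume "z \<in> p ` {a<..<b}"
    then show "z \<in> {z\<in>N. f z = 0}"
      using pU fp by (auto simp: N_def p_def)
  qed

  \<comment> \<open>If \<open>f'\<close> killed \<open>ej\<close> at a point of the curve, then so would \<open>H'\<close>, contrary to injectivity.\<close>
  have nz_curve: "f' (p x) ej \<noteq> 0" if "x \<in> {a<..<b}" for x
  proof
    assume "f' (p x) ej = 0"
    then have "H' (p x) ej = H' (p x) 0"
      by (simp add: H'_apply)
    then have "ej = 0"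
      using bij[OF axisV[OF that]] k_eq_p[OF that] by (metis bij_is_inj injD)
    then show False
      using comp(4) by simp
  qed

  have derg: "(g has_real_derivative - (f' (p x) ei / f' (p x) ej)) (at x)"
    if x: "x \<in> {a<..<b}" for x
  proof -
    have "((\<lambda>x. k (x *\<^sub>R ei)) has_derivative (\<lambda>h. k' (x *\<^sub>R ei) (h *\<^sub>R ei))) (at x)"
      by (rule has_derivative_compose[where g = k])
        (auto intro!: derivative_eq_intros derk axisV[OF x])
    then have "(\<lambda>x. k (x *\<^sub>R ei)) differentiable (at x)"
      by (rule differentiableI)
    then have "g differentiable (at x)"
      unfolding g_def by (auto simp: differentiable_def
          intro: bounded_linear.has_derivative[OF bounded_linear_vec_nth])
    then obtain m where m: "(g has_real_derivative m) (at x)"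
      using real_differentiable_def by blast
    then have "(g has_derivative (\<lambda>h. h * m)) (at x)"
      by (simp add: has_field_derivative_def mult_commute_abs)
    then have "(p has_derivative (\<lambda>h. h *\<^sub>R ei + (h * m) *\<^sub>R ej)) (at x)"
      unfolding p_def by (auto intro!: derivative_eq_intros)
    then have
      "((\<lambda>x. f (p x)) has_derivative (\<lambda>h. f' (p x) (h *\<^sub>R ei + (h * m) *\<^sub>R ej))) (at x)"
      by (rule has_derivative_compose[where g = f]) (use der pU[OF x] U(2) in auto)
    moreover have "((\<lambda>x. f (p x)) has_derivative (\<lambda>h. 0)) (at x)"
    proof (rule has_derivative_transform_within_open)
      show "((\<lambda>_. 0) has_derivative (\<lambda>h. 0)) (at x)" by simp
    qed (use x fp in \<open>auto intro: open_greaterThanLessThan[of a b]\<close>)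
    ultimately have "(\<lambda>h. f' (p x) (h *\<^sub>R ei + (h * m) *\<^sub>R ej)) = (\<lambda>h. 0)"
      by (rule has_derivative_unique)
    from fun_cong[OF this, of 1] have "f' (p x) ei + m * f' (p x) ej = 0"
      by (simp add: blinfun.add_right blinfun.scaleR_right)
    then have "m = - (f' (p x) ei / f' (p x) ej)"
      using nz_curve[OF x] by (simp add: field_simps)
    with m show ?thesis by simp
  qed

  have "continuous_on {a<..<b} g"
    using derg by (meson DERIV_isCont continuous_at_imp_continuous_on)
  then have "continuous_on {a<..<b} p"
    unfolding p_def by (intro continuous_intros)
  then have "continuous_on {a<..<b} (\<lambda>x. f' (p x))"
    using pU U(2) by (intro continuous_on_compose2[OF cont]) auto
  then have "continuous_on {a<..<b} (\<lambda>x. - (f' (p x) ei / f' (p x) ej))"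
    using nz_curve by (intro continuous_intros) auto
  then have C1: "g C1_differentiable_on {a<..<b}"
    unfolding C1_differentiable_on_def
    by (intro exI[of _ "\<lambda>x. - (f' (p x) ei / f' (p x) ej)"])
      (simp add: derg flip: has_real_derivative_iff_has_vector_derivative)

  show thesis
  proof (rule that[of N a b g, folded ei_def ej_def, folded p_def])
    show "z0 \<in> N" "N \<subseteq> S"
      using U ab by (auto simp: N_def)
    show "g (z0 $ i) = z0 $ j"
      using kH(1)[OF U(3)] Hzero[OF \<open>f z0 = 0\<close>] by (simp add: g_def)
  qed (fact \<open>open N\<close> ab zero_set C1 | erule nz_curve derg)+
qed

lemma partial_deriv_eq:
  assumes "(f has_derivative f') (at z)"
  shows "partial_deriv i f z = f' (axis i 1)"
proof -
  interpret f': bounded_linear f'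
    using assms by (rule has_derivative_bounded_linear)
  have line: "((\<lambda>h. z + h *\<^sub>R axis i 1) has_derivative (\<lambda>h. h *\<^sub>R axis i 1)) (at 0)"
    by (auto intro!: derivative_eq_intros)
  have "((\<lambda>h. f (z + h *\<^sub>R axis i 1)) has_derivative (\<lambda>h. f' (h *\<^sub>R axis i 1))) (at 0)"
    by (rule has_derivative_compose[OF line]) (use assms in simp)
  then have "((\<lambda>h. f (z + h *\<^sub>R axis i 1)) has_real_derivative f' (axis i 1)) (at 0)"
    by (simp add: has_field_derivative_def f'.scaleR mult_commute_abs)
  then show ?thesis
    unfolding partial_deriv_def by (rule DERIV_imp_deriv)
qed

lemma vector_2_eq_axis: "vector [x, y] = x *\<^sub>R axis 1 1 + y *\<^sub>R (axis 2 1 :: real^2)"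
  by (simp add: vec_eq_iff forall_2 axis_def)

theorem theorem7p2:
  fixes G :: "real^2 \<Rightarrow> real \<Rightarrow> real^2"
    and \<phi> :: "real \<Rightarrow> real \<Rightarrow> real^2 \<Rightarrow> real^2"
    and \<theta> :: "real^2 \<Rightarrow> real \<Rightarrow> real"
    and t x0 y0 :: real
    and z0 :: "real^2"
    and \<Omega> :: "(real^2) set"
  defines "\<theta>x \<equiv> partial_deriv 1 (\<lambda>z. \<theta> z t)"
    and "\<theta>y \<equiv> partial_deriv 2 (\<lambda>z. \<theta> z t)"
  assumes "generates_flow G \<phi>"
    and "t > 0"
    and "open \<Omega>"
    and "\<forall>z\<in>\<Omega>. included_angle \<phi> t z (\<theta> z t)"
    and "C1_on (\<lambda>z. \<theta> z t) \<Omega>"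
    and "z0 = vector [x0, y0]"
    and "z0 \<in> \<Omega>"
    and "\<theta> z0 t = 0"
  shows "(\<theta>y z0 \<noteq> 0 \<longrightarrow>
           (\<exists>N a b g1. open N \<and> z0 \<in> N \<and> N \<subseteq> \<Omega> \<and>
              g1 C1_differentiable_on {a<..<b} \<and>
              {z\<in>N. \<theta> z t = 0} = (\<lambda>x. vector [x, g1 x]) ` {a<..<b} \<and>
              (\<forall>x\<in>{a<..<b}. \<theta>y (vector [x, g1 x]) \<noteq> 0) \<and>
              solves_ivp_on {a<..<b}
                (\<lambda>x y. - (\<theta>x (vector [x, y]) / \<theta>y (vector [x, y]))) x0 y0 g1)) \<and>
         (\<theta>x z0 \<noteq> 0 \<longrightarrow>
           (\<exists>N a b g2. open N \<and> z0 \<in> N \<and> N \<subseteq> \<Omega> \<and>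
              g2 C1_differentiable_on {a<..<b} \<and>
              {z\<in>N. \<theta> z t = 0} = (\<lambda>y. vector [g2 y, y]) ` {a<..<b} \<and>
              (\<forall>y\<in>{a<..<b}. \<theta>x (vector [g2 y, y]) \<noteq> 0) \<and>
              solves_ivp_on {a<..<b}
                (\<lambda>y x. - (\<theta>y (vector [x, y]) / \<theta>x (vector [x, y]))) y0 x0 g2))"
proof -
  obtain f' where der: "\<forall>z\<in>\<Omega>. ((\<lambda>z. \<theta> z t) has_derivative blinfun_apply (f' z)) (at z)"
    and cont: "continuous_on \<Omega> f'"
    using \<open>C1_on (\<lambda>z. \<theta> z t) \<Omega>\<close> unfolding C1_on_def by blast
  have \<theta>x: "\<theta>x z = f' z (axis 1 1)" and \<theta>y: "\<theta>y z = f' z (axis 2 1)" if "z \<in> \<Omega>" for z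
    using partial_deriv_eq[OF der[rule_format, OF that]] by (simp_all add: \<theta>x_def \<theta>y_def)
  note graph = zero_set_locally_graph[where f = "\<lambda>z. \<theta> z t", OF _ \<open>open \<Omega>\<close> der cont \<open>z0 \<in> \<Omega>\<close> \<open>\<theta> z0 t = 0\<close>]
  have z0: "z0 $ 1 = x0" "z0 $ 2 = y0"
    using \<open>z0 = vector [x0, y0]\<close> by simp_all
  show ?thesis
  proof (intro conjI impI)
    assume "\<theta>y z0 \<noteq> 0"
    then have "f' z0 (axis 2 1) \<noteq> 0"
      using \<theta>y[OF \<open>z0 \<in> \<Omega>\<close>] by simp
    then obtain N a b g where N: "open N" "z0 \<in> N" "N \<subseteq> \<Omega>"
      and init: "x0 \<in> {a<..<b}" "g x0 = y0"
      and zero: "{z\<in>N. \<theta> z t = 0} = (\<lambda>x. vector [x, g x]) ` {a<..<b}"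
      and nz: "\<And>x. x \<in> {a<..<b} \<Longrightarrow> f' (vector [x, g x]) (axis 2 1) \<noteq> 0"
      and ode: "\<And>x. x \<in> {a<..<b} \<Longrightarrow> (g has_real_derivative
        - (f' (vector [x, g x]) (axis 1 1) / f' (vector [x, g x]) (axis 2 1))) (at x)"
      and C1: "g C1_differentiable_on {a<..<b}"
      by (rule graph[of 1 2, folded vector_2_eq_axis, unfolded z0, rotated]) (auto intro: that)
    have "vector [x, g x] \<in> \<Omega>" if "x \<in> {a<..<b}" for x
      using zero N(3) that by blast
    then show "\<exists>N a b g1. open N \<and> z0 \<in> N \<and> N \<subseteq> \<Omega> \<and>
        g1 C1_differentiable_on {a<..<b} \<and>
        {z\<in>N. \<theta> z t = 0} = (\<lambda>x. vector [x, g1 x]) ` {a<..<b} \<and>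
        (\<forall>x\<in>{a<..<b}. \<theta>y (vector [x, g1 x]) \<noteq> 0) \<and>
        solves_ivp_on {a<..<b}
          (\<lambda>x y. - (\<theta>x (vector [x, y]) / \<theta>y (vector [x, y]))) x0 y0 g1"
      using N init zero nz ode C1
      by (intro exI[of _ N] exI[of _ a] exI[of _ b] exI[of _ g])
        (simp add: solves_ivp_on_def \<theta>x \<theta>y)
  next
    assume "\<theta>x z0 \<noteq> 0"
    then have "f' z0 (axis 1 1) \<noteq> 0"
      using \<theta>x[OF \<open>z0 \<in> \<Omega>\<close>] by simp
    then obtain N a b g where N: "open N" "z0 \<in> N" "N \<subseteq> \<Omega>"
      and init: "y0 \<in> {a<..<b}" "g y0 = x0"
      and zero: "{z\<in>N. \<theta> z t = 0} = (\<lambda>y. vector [g y, y]) ` {a<..<b}"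
      and nz: "\<And>y. y \<in> {a<..<b} \<Longrightarrow> f' (vector [g y, y]) (axis 1 1) \<noteq> 0"
      and ode: "\<And>y. y \<in> {a<..<b} \<Longrightarrow> (g has_real_derivative
        - (f' (vector [g y, y]) (axis 2 1) / f' (vector [g y, y]) (axis 1 1))) (at y)"
      and C1: "g C1_differentiable_on {a<..<b}"
      by (rule graph[of 2 1, unfolded add.commute[of "_ *\<^sub>R axis 2 1"], folded vector_2_eq_axis,
            unfolded z0, rotated]) (auto intro: that)
    have "vector [g y, y] \<in> \<Omega>" if "y \<in> {a<..<b}" for y
      using zero N(3) that by blast
    then show "\<exists>N a b g2. open N \<and> z0 \<in> N \<and> N \<subseteq> \<Omega> \<and>
        g2 C1_differentiable_on {a<..<b} \<and>
        {z\<in>N. \<theta> z t = 0} = (\<lambda>y. vector [g2 y, y]) ` {a<..<b} \<and>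
        (\<forall>y\<in>{a<..<b}. \<theta>x (vector [g2 y, y]) \<noteq> 0) \<and>
        solves_ivp_on {a<..<b}
          (\<lambda>y x. - (\<theta>y (vector [x, y]) / \<theta>x (vector [x, y]))) y0 x0 g2"
      using N init zero nz ode C1
      by (intro exI[of _ N] exI[of _ a] exI[of _ b] exI[of _ g])
        (simp add: solves_ivp_on_def \<theta>x \<theta>y)
  qed
qed

end
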